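(* Let $T$ be a non-degenerate simplex in $\mathbb{R}^d$ with vertices ${\bf v}_0,{\bf v}_1,\ldots,{\bf v}_d$, circumcenter ${\bf c}$ and circumradius $R$, let $P$ be an admissible domain for $T$, and let ${\bf w}\in P$ be an arbitrary point. Then $$\sup\{f({\bf w}) : f\in W^2(P),\ I(f)={\bf 0}\}=\mathcal E({\bf w}),\qquad\text{where}\quad \mathcal E({\bf w})=\frac{R^2}{4}+|{\bf w}-\varphi({\bf w})|^2-\frac12|{\bf w}-{\bf c}|^2.$$
   Context: $|\cdot|$ is the Euclidean norm on $\mathbb{R}^d$. A simplex $T\subset\mathbb{R}^d$ with vertices ${\bf v}_0,\ldots,{\bf v}_d$ is non-degenerate if it is not contained in any $(d-1)$-dimensional hyperplane. Its circumcenter ${\bf c}$ is the point equidistant from all vertices and $R=|{\bf c}-{\bf v}_i|$. Let $\Sigma=\{0,1,\ldots,d\}$, ${\bf u}_i=\frac12({\bf c}+{\bf v}_i)$ for $i\in\Sigma$, and $U=\frac12({\bf c}+T)$, the simplex with vertices ${\bf u}_0,\ldots,{\bf u}_d$. For ${\bf x}\in U$, $b_0({\bf x}),\ldots,b_d({\bf x})$ are the barycentric coordinates of ${\bf x}$ relative to $U$. For non-empty $I\subset\Sigma$, $G_I:=\{{\bf x}\in U: b_i({\bf x})>0\text{ for }i\in I,\ b_i({\bf x})=0\text{ for }i\notin I\}$. The mapping $\varphi:\mathbb{R}^d\to U$ sends ${\bf x}$ to the unique point of $U$ closest to ${\bf x}$. A closed convex set $P\subset\mathbb{R}^d$ is an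 admissible domain for $T$ if $P\supset T$ and for every ${\bf x}\in P$ we have ${\bf x}-\varphi({\bf x})+{\bf u}_i\in P$ for all $i\in I$, where $I\subset\Sigma$ is the (unique) subset such that $\varphi({\bf x})\in G_I$. $C^1(P)$ is the space of continuously differentiable real functions on $P$. $W^2_\infty[a,b]$ is the class of functions $g:[a,b]\to\mathbb{R}$ such that $g'$ is absolutely continuous on $[a,b]$ and $|g''(t)|\le1$ for a.e. $t\in[a,b]$ (equivalently, $g'$ exists everywhere on $[a,b]$ and $|g'(t_1)-g'(t_2)|\le|t_1-t_2|$ for all $t_1,t_2\in[a,b]$). $W^2(P)$ is the class of $f\in C^1(P)$ such that for any two distinct points ${\bf x},{\bf y}\in P$, with $\rho=|{\bf y}-{\bf x}|$, the function $g(t)=f({\bf x}+\frac t\rho({\bf y}-{\bf x}))$, $t\in[0,\rho]$, belongs to $W^2_\infty[0,\rho]$. The information vector is $I(f):=(f({\bf v}_0),\ldots,f({\bf v}_d),\nabla f({\bf v}_0),\ldots,\nabla f({\bf v}_d))\in\mathbb{R}^{(d+1)^2}$ (not to be confused with the index sets $I\subset\Sigma$). *)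

theory Defs
  imports "HOL-Analysis.Analysis"
begin

text \<open>
  The ambient space is a Euclidean space of dimension \<open>d = DIM('a)\<close> (so \<open>d \<ge> 1\<close>).
  The vertices \<open>v\<^sub>0, \<dots>, v\<^sub>d\<close> are given by a function \<open>v :: nat \<Rightarrow> 'a\<close>; only its values on the
  index set \<open>\<Sigma> = {0, \<dots>, d}\<close> matter.
\<close>

definition Sigma_idx :: "'a::euclidean_space itself \<Rightarrow> nat set" where
  "Sigma_idx _ = {0..DIM('a)}"

definition simplex_of :: "(nat \<Rightarrow> 'a::euclidean_space) \<Rightarrow> 'a set" where
  "simplex_of v = convex hull (v ` Sigma_idx TYPE('a))"

definition nondegenerate :: "(nat \<Rightarrow> 'a::euclidean_space) \<Rightarrow> bool" where
  "nondegenerate v \<longleftrightarrow>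
     \<not> (\<exists>H. affine H \<and> aff_dim H = int DIM('a) - 1 \<and> simplex_of v \<subseteq> H)"

definition circumcenter :: "(nat \<Rightarrow> 'a::euclidean_space) \<Rightarrow> 'a" where
  "circumcenter v = (THE c. \<exists>r. \<forall>i\<in>Sigma_idx TYPE('a). norm (c - v i) = r)"

definition circumradius :: "(nat \<Rightarrow> 'a::euclidean_space) \<Rightarrow> real" where
  "circumradius v = norm (circumcenter v - v 0)"

definition half_vertex :: "(nat \<Rightarrow> 'a::euclidean_space) \<Rightarrow> nat \<Rightarrow> 'a" where
  "half_vertex v i = (1/2) *\<^sub>R (circumcenter v + v i)"

definition half_simplex :: "(nat \<Rightarrow> 'a::euclidean_space) \<Rightarrow> 'a set" where
  "half_simplex v = simplex_of (half_vertex v)"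

text \<open>
  Barycentric coordinates of \<open>x\<close> relative to the simplex with vertices \<open>u\<^sub>0, \<dots>, u\<^sub>d\<close>. For a
  non-degenerate simplex the values at the indices in \<open>\<Sigma>\<close> are uniquely determined; the values at
  other indices are irrelevant, which is why the choice operator is applied to the whole
  coordinate function.
\<close>

definition barycentric :: "(nat \<Rightarrow> 'a::euclidean_space) \<Rightarrow> 'a \<Rightarrow> nat \<Rightarrow> real" where
  "barycentric u x = (SOME b. (\<Sum>i\<in>Sigma_idx TYPE('a). b i) = 1 \<and>
                              (\<Sum>i\<in>Sigma_idx TYPE('a). b i *\<^sub>R u i) = x)"

definition open_face :: "(nat \<Rightarrow> 'a::euclidean_space) \<Rightarrow> nat set \<Rightarrow> 'a set" where
  "open_face v I = {x \<in> half_simplex v.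
     (\<forall>i\<in>I. barycentric (half_vertex v) x i > 0) \<and>
     (\<forall>i\<in>Sigma_idx TYPE('a) - I. barycentric (half_vertex v) x i = 0)}"

definition proj :: "(nat \<Rightarrow> 'a::euclidean_space) \<Rightarrow> 'a \<Rightarrow> 'a" where
  "proj v x = closest_point (half_simplex v) x"

definition admissible_domain :: "(nat \<Rightarrow> 'a::euclidean_space) \<Rightarrow> 'a set \<Rightarrow> bool" where
  "admissible_domain v P \<longleftrightarrow> closed P \<and> convex P \<and> simplex_of v \<subseteq> P \<and>
     (\<forall>x\<in>P. \<forall>I. I \<noteq> {} \<and> I \<subseteq> Sigma_idx TYPE('a) \<and> proj v x \<in> open_face v I \<longrightarrow>
        (\<forall>i\<in>I. x - proj v x + half_vertex v i \<in> P))"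

text \<open>
  Differentiability on the closed set \<open>P\<close> is relative to \<open>P\<close> (filter \<open>at x within P\<close>). For convex
  \<open>P\<close> with non-empty interior, in particular for admissible domains of non-degenerate simplices,
  the gradient relative to \<open>P\<close> is unique at every point of \<open>P\<close>, boundary points included.
\<close>

definition gradient_within :: "('a::euclidean_space) set \<Rightarrow> ('a \<Rightarrow> real) \<Rightarrow> 'a \<Rightarrow> 'a" where
  "gradient_within P f x = (THE g. (f has_derivative (\<lambda>h. g \<bullet> h)) (at x within P))"

definition C1 :: "('a::euclidean_space) set \<Rightarrow> ('a \<Rightarrow> real) set" where
  "C1 P = {f. (\<forall>x\<in>P. f differentiable (at x within P)) \<and> continuous_on P (gradient_within P f)}"

text \<open>
  The derivative at the endpoints of \<open>[a, b]\<close> is one-sided. The condition that \<open>g'\<close> is absolutely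
  continuous with \<open>\<bar>g''\<bar> \<le> 1\<close> almost everywhere is expressed as: \<open>g'\<close> is Lipschitz with constant 1.
\<close>

definition W2_infty :: "real \<Rightarrow> real \<Rightarrow> (real \<Rightarrow> real) set" where
  "W2_infty a b = {g. \<exists>g'.
     (\<forall>t\<in>{a..b}. (g has_real_derivative g' t) (at t within {a..b})) \<and>
     (\<forall>t1\<in>{a..b}. \<forall>t2\<in>{a..b}. \<bar>g' t1 - g' t2\<bar> \<le> \<bar>t1 - t2\<bar>)}"

definition W2 :: "('a::euclidean_space) set \<Rightarrow> ('a \<Rightarrow> real) set" where
  "W2 P = {f \<in> C1 P. \<forall>x\<in>P. \<forall>y\<in>P. x \<noteq> y \<longrightarrow>
     (\<lambda>t. f (x + (t / norm (y - x)) *\<^sub>R (y - x))) \<in> W2_infty 0 (norm (y - x))}"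

text \<open>
  The information vector, grouped by vertices: the \<open>i\<close>-th block consists of the value and the
  gradient at \<open>v\<^sub>i\<close>.
\<close>

definition info :: "('a::euclidean_space) set \<Rightarrow> (nat \<Rightarrow> 'a) \<Rightarrow> ('a \<Rightarrow> real) \<Rightarrow> nat \<Rightarrow> real \<times> 'a" where
  "info P v f i = (f (v i), gradient_within P f (v i))"

definition error_fun :: "(nat \<Rightarrow> 'a::euclidean_space) \<Rightarrow> 'a \<Rightarrow> real" where
  "error_fun v w = (circumradius v)\<^sup>2 / 4 + (norm (w - proj v w))\<^sup>2
                   - (norm (w - circumcenter v))\<^sup>2 / 2"

end

theory Submission
  imports Defs
begin

text \<open>
  The function \<open>\<E>\<close> is itself extremal. Its gradient is \<open>x - 2\<phi>(x) + c\<close>, which is 1-Lipschitz because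
  \<open>\<phi>\<close> is a metric projection onto a convex set, hence firmly nonexpansive; and \<open>\<E>\<close> and its gradient
  vanish at the vertices since \<open>\<phi>(v\<^sub>i) = u\<^sub>i\<close>. Conversely, \<open>f(w) \<le> \<E>(w)\<close> follows from Taylor
  estimates from \<open>v\<^sub>i\<close> to \<open>y\<^sub>i = w - \<phi>(w) + u\<^sub>i\<close> and from \<open>w\<close> to \<open>y\<^sub>i\<close>; averaging over \<open>i\<close> with
  the barycentric coordinates of \<open>\<phi>(w)\<close> eliminates the unknown gradient of \<open>f\<close> at \<open>w\<close>.
  Admissibility of \<open>P\<close> says exactly that the points \<open>y\<^sub>i\<close> involved lie in \<open>P\<close>.
\<close>

section \<open>Gradients relative to a convex set\<close>

lemma has_derivative_along_segment:
  fixes f :: "'a::euclidean_space \<Rightarrow> real"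
  assumes "convex P" "x \<in> P" "y \<in> P" "t \<in> {0..1}"
    and D: "(f has_derivative (\<lambda>h. g \<bullet> h)) (at (x + t *\<^sub>R (y - x)) within P)"
  shows "((\<lambda>t. f (x + t *\<^sub>R (y - x))) has_real_derivative g \<bullet> (y - x)) (at t within {0..1})"
proof -
  have sub: "(\<lambda>t. x + t *\<^sub>R (y - x)) ` {0..1} \<subseteq> P"
  proof clarify
    fix s :: real assume "s \<in> {0..1}"
    then have "(1 - s) *\<^sub>R x + s *\<^sub>R y \<in> P"
      using assms(1-3) by (auto simp: convex_alt)
    then show "x + s *\<^sub>R (y - x) \<in> P"
      by (simp add: algebra_simps)
  qed
  have "((\<lambda>t. f (x + t *\<^sub>R (y - x))) has_derivative (\<lambda>s. g \<bullet> (s *\<^sub>R (y - x)))) (at t within {0..1})"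
    by (rule has_derivative_in_compose[OF _ has_derivative_subset[OF D sub]])
       (auto intro!: derivative_eq_intros)
  moreover have "(\<lambda>s. g \<bullet> (s *\<^sub>R (y - x))) = (*) (g \<bullet> (y - x))"
    by auto
  ultimately show ?thesis
    by (simp only: has_field_derivative_def)
qed

text \<open>A nonzero \<open>a\<close> would confine \<open>P\<close> to a hyperplane, whose
  dimension is too small. Full dimension enters in this form twice: for uniqueness of gradients and
  for uniqueness of the circumcenter.\<close>

lemma inner_constant_imp_0:
  fixes P :: "'a::euclidean_space set"
  assumes "aff_dim P = int DIM('a)" "\<And>z. z \<in> P \<Longrightarrow> a \<bullet> z = b"
  shows "a = 0"
proof (rule ccontr)
  assume "a \<noteq> 0"
  then have "aff_dim {x. a \<bullet> x = b} = int DIM('a) - 1"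
    by simp
  moreover have "aff_dim P \<le> aff_dim {x. a \<bullet> x = b}"
    using assms(2) by (intro aff_dim_subset) auto
  ultimately show False
    using assms(1) by simp
qed

text \<open>At a boundary point only the directions \<open>z - x\<close> with \<open>z\<close> in
  \<open>P\<close> can be tested, through one-sided derivatives along segments. Two gradients agree
  on all of these, so their difference has constant inner product with the points of
  \<open>P\<close>.\<close>

lemma gradient_unique_within:
  fixes f :: "'a::euclidean_space \<Rightarrow> real"
  assumes "convex P" "aff_dim P = int DIM('a)" "x \<in> P"
    and "(f has_derivative (\<lambda>h. g \<bullet> h)) (at x within P)"
    and "(f has_derivative (\<lambda>h. g' \<bullet> h)) (at x within P)"
  shows "g = g'"
proof -
  have "(g - g') \<bullet> z = (g - g') \<bullet> x" if "z \<in> P" for z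
  proof -
    have "g \<bullet> (z - x) = g' \<bullet> (z - x)"
    proof (rule has_field_derivative_unique)
      show "((\<lambda>t. f (x + t *\<^sub>R (z - x))) has_real_derivative g \<bullet> (z - x)) (at 0 within {0..1})"
        "((\<lambda>t. f (x + t *\<^sub>R (z - x))) has_real_derivative g' \<bullet> (z - x)) (at 0 within {0..1})"
        using assms that by (auto intro!: has_derivative_along_segment[of P])
      show "at (0::real) within {0..1} \<noteq> bot"
        by (simp add: at_within_Icc_at_right)
    qed
    then show ?thesis
      by (simp add: inner_diff_left inner_diff_right)
  qed
  then have "g - g' = 0"
    by (rule inner_constant_imp_0[OF assms(2)])
  then show ?thesis by simp
qed

lemma gradient_within_eq:
  fixes f :: "'a::euclidean_space \<Rightarrow> real"
  assumes "convex P" "aff_dim P = int DIM('a)" "x \<in> P"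
    and "(f has_derivative (\<lambda>h. g \<bullet> h)) (at x within P)"
  shows "gradient_within P f x = g"
  unfolding gradient_within_def
  using assms gradient_unique_within by (blast intro: the_equality)

lemma has_derivative_gradient_within:
  fixes f :: "'a::euclidean_space \<Rightarrow> real"
  assumes "convex P" "aff_dim P = int DIM('a)" "x \<in> P" "f differentiable (at x within P)"
  shows "(f has_derivative (\<lambda>h. gradient_within P f x \<bullet> h)) (at x within P)"
proof -
  obtain D where D: "(f has_derivative D) (at x within P)"
    using assms(4) by (auto simp: differentiable_def)
  then have lin: "linear D"
    by (rule has_derivative_linear)
  \<comment> \<open>The Riesz representative of the functional \<open>D\<close>, written in
    coordinates.\<close>
  define g where "g = (\<Sum>b\<in>Basis. D b *\<^sub>R b)"
  have "D = (\<lambda>h. g \<bullet> h)"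
  proof
    fix h
    have "D h = D (\<Sum>b\<in>Basis. (h \<bullet> b) *\<^sub>R b)"
      by (simp add: euclidean_representation)
    also have "\<dots> = (\<Sum>b\<in>Basis. (h \<bullet> b) * D b)"
      by (simp add: linear_sum[OF lin] linear_cmul[OF lin])
    also have "\<dots> = g \<bullet> h"
      by (simp add: g_def inner_sum_left inner_commute[of h] mult.commute)
    finally show "D h = g \<bullet> h" .
  qed
  with D gradient_within_eq[OF assms(1-3)] show ?thesis
    by metis
qed

section \<open>Taylor estimate for functions in \<open>W\<^sup>2(P)\<close>\<close>

text \<open>Since the derivative at t differs from that at 0 by at most t, the functions g(t) - t g0
  - t^2/2 and g(t) - t g0 + t^2/2 are compared at 0 and \<open>r\<close> by the mean value theorem:
  the derivative of the first is never positive, that of the second never negative.\<close>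

lemma W2_infty_taylor:
  assumes "0 < r" "g \<in> W2_infty 0 r" "(g has_real_derivative g0) (at 0 within {0..r})"
  shows "\<bar>g r - g 0 - r * g0\<bar> \<le> r\<^sup>2 / 2"
proof -
  obtain g' where g': "\<And>t. t \<in> {0..r} \<Longrightarrow> (g has_real_derivative g' t) (at t within {0..r})"
    and lip: "\<And>s t. s \<in> {0..r} \<Longrightarrow> t \<in> {0..r} \<Longrightarrow> \<bar>g' s - g' t\<bar> \<le> \<bar>s - t\<bar>"
    using assms(2) unfolding W2_infty_def by blast
  \<comment> \<open>The Lipschitz witness \<open>g'\<close> comes from an existential; uniqueness of
    the one-sided derivative identifies its value at 0 with the given \<open>g0\<close>.\<close>
  have g0: "g0 = g' 0"
    using assms(1) g'[of 0] assms(3)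
    by (intro has_field_derivative_unique[of g g0 0 "{0..r}"]) (auto simp: at_within_Icc_at_right)
  have "g r - r * g0 - r\<^sup>2 / 2 \<le> g 0 - 0 * g0 - 0\<^sup>2 / 2"
  proof -
    have "\<exists>x\<in>{0..r}. (g r - r * g0 - r\<^sup>2 / 2) - (g 0 - 0 * g0 - 0\<^sup>2 / 2) = (g' x - g0 - x) * (r - 0)"
      using assms(1)
      by (intro mvt_very_simple[where f = "\<lambda>t. g t - t * g0 - t\<^sup>2 / 2" and f' = "\<lambda>x h. (g' x - g0 - x) * h"])
         (auto intro!: derivative_eq_intros g' simp flip: has_field_derivative_def)
    then obtain x where "x \<in> {0..r}"
      "(g r - r * g0 - r\<^sup>2 / 2) - (g 0 - 0 * g0 - 0\<^sup>2 / 2) = (g' x - g0 - x) * r"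
      by auto
    moreover have "(g' x - g0 - x) * r \<le> 0"
      using lip[of x 0] \<open>x \<in> {0..r}\<close> assms(1) by (intro mult_nonpos_nonneg) (auto simp: g0)
    ultimately show ?thesis by linarith
  qed
  moreover have "g r - r * g0 + r\<^sup>2 / 2 \<ge> g 0 - 0 * g0 + 0\<^sup>2 / 2"
  proof -
    have "\<exists>x\<in>{0..r}. (g r - r * g0 + r\<^sup>2 / 2) - (g 0 - 0 * g0 + 0\<^sup>2 / 2) = (g' x - g0 + x) * (r - 0)"
      using assms(1)
      by (intro mvt_very_simple[where f = "\<lambda>t. g t - t * g0 + t\<^sup>2 / 2" and f' = "\<lambda>x h. (g' x - g0 + x) * h"])
         (auto intro!: derivative_eq_intros g' simp flip: has_field_derivative_def)
    then obtain x where "x \<in> {0..r}"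
      "(g r - r * g0 + r\<^sup>2 / 2) - (g 0 - 0 * g0 + 0\<^sup>2 / 2) = (g' x - g0 + x) * r"
      by auto
    moreover have "(g' x - g0 + x) * r \<ge> 0"
      using lip[of x 0] \<open>x \<in> {0..r}\<close> assms(1) by (intro mult_nonneg_nonneg) (auto simp: g0)
    ultimately show ?thesis by linarith
  qed
  ultimately show ?thesis unfolding abs_le_iff by simp
qed

text \<open>This is the arc length parametrisation that occurs in \<open>W2\<close>, obtained by
  rescaling the unit interval.\<close>

lemma has_derivative_along_unit_segment:
  fixes f :: "'a::euclidean_space \<Rightarrow> real"
  assumes "convex P" "x \<in> P" "y \<in> P" "x \<noteq> y" "t \<in> {0..norm (y - x)}"
    and D: "(f has_derivative (\<lambda>h. g \<bullet> h)) (at (x + (t / norm (y - x)) *\<^sub>R (y - x)) within P)"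
  shows "((\<lambda>t. f (x + (t / norm (y - x)) *\<^sub>R (y - x))) has_real_derivative
           g \<bullet> ((1 / norm (y - x)) *\<^sub>R (y - x))) (at t within {0..norm (y - x)})"
proof -
  let ?r = "norm (y - x)"
  have r: "0 < ?r" using assms(4) by simp
  have img: "(\<lambda>t. t / ?r) ` {0..?r} \<subseteq> {0..1}"
    using r by auto
  have "t / ?r \<in> {0..1}" using assms(5) r by auto
  then have D1: "((\<lambda>t. f (x + t *\<^sub>R (y - x))) has_real_derivative g \<bullet> (y - x)) (at (t / ?r) within (\<lambda>t. t / ?r) ` {0..?r})"
    using has_derivative_along_segment[OF assms(1-3) _ D] img by (blast intro: DERIV_subset)
  have "((\<lambda>t. t / ?r) has_real_derivative 1 / ?r) (at t within {0..?r})"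
    using r by (auto intro!: derivative_eq_intros)
  from DERIV_image_chain[OF D1 this] show ?thesis
    by (simp add: o_def)
qed

lemma W2_taylor:
  fixes f :: "'a::euclidean_space \<Rightarrow> real"
  assumes "convex P" "aff_dim P = int DIM('a)" "f \<in> W2 P" "x \<in> P" "y \<in> P"
  shows "\<bar>f y - f x - gradient_within P f x \<bullet> (y - x)\<bar> \<le> (norm (y - x))\<^sup>2 / 2"
proof (cases "x = y")
  case False
  let ?r = "norm (y - x)" and ?g = "gradient_within P f x"
  have r: "0 < ?r" using False by simp
  have "f differentiable (at x within P)"
    using assms(3,4) by (auto simp: W2_def C1_def)
  then have D: "(f has_derivative (\<lambda>h. ?g \<bullet> h)) (at x within P)"
    using assms by (intro has_derivative_gradient_within)
  \<comment> \<open>The quotients \<open>?r / ?r\<close> and \<open>0 / ?r\<close> stay unsimplified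
    so that both values of \<open>f\<close> are instances of the parametrised function.\<close>
  have "\<bar>f (x + (?r / ?r) *\<^sub>R (y - x)) - f (x + (0 / ?r) *\<^sub>R (y - x)) -
      ?r * (?g \<bullet> ((1 / ?r) *\<^sub>R (y - x)))\<bar> \<le> ?r\<^sup>2 / 2"
  proof (rule W2_infty_taylor[OF r])
    show "(\<lambda>t. f (x + (t / ?r) *\<^sub>R (y - x))) \<in> W2_infty 0 ?r"
      using assms(3-5) False by (auto simp: W2_def)
    show "((\<lambda>t. f (x + (t / ?r) *\<^sub>R (y - x))) has_real_derivative ?g \<bullet> ((1 / ?r) *\<^sub>R (y - x)))
        (at 0 within {0..?r})"
      using D False by (intro has_derivative_along_unit_segment[OF assms(1,4,5)]) auto
  qed
  then show ?thesis using r False by simp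
qed simp

text \<open>Along a line with unit direction \<open>e\<close> the derivative of \<open>f\<close> is
  the component of \<open>G\<close> along \<open>e\<close>, and Cauchy-Schwarz carries the Lipschitz
  bound over to it.\<close>

lemma W2_I:
  fixes f :: "'a::euclidean_space \<Rightarrow> real"
  assumes "convex P" "aff_dim P = int DIM('a)"
    and D: "\<And>x. (f has_derivative (\<lambda>h. G x \<bullet> h)) (at x)"
    and lip: "\<And>x y. norm (G x - G y) \<le> norm (x - y)"
  shows "f \<in> W2 P"
proof -
  have Dw: "(f has_derivative (\<lambda>h. G x \<bullet> h)) (at x within P)" for x
    using D by (rule has_derivative_at_withinI)
  have "continuous_on P G"
    unfolding continuous_on_iff dist_norm using lip by (meson le_less_trans)
  then have "continuous_on P (gradient_within P f)"
    using gradient_within_eq[OF assms(1,2) _ Dw] by (simp cong: continuous_on_cong)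
  then have "f \<in> C1 P"
    using Dw by (auto simp: C1_def differentiable_def)
  moreover have "(\<lambda>t. f (x + (t / norm (y - x)) *\<^sub>R (y - x))) \<in> W2_infty 0 (norm (y - x))"
    if "x \<in> P" "y \<in> P" "x \<noteq> y" for x y
  proof -
    define e where "e = (1 / norm (y - x)) *\<^sub>R (y - x)"
    have e: "norm e = 1" using that by (simp add: e_def)
    have eq: "(t / norm (y - x)) *\<^sub>R (y - x) = t *\<^sub>R e" for t
      by (simp add: e_def)
    have "\<bar>G (x + s *\<^sub>R e) \<bullet> e - G (x + t *\<^sub>R e) \<bullet> e\<bar> \<le> \<bar>s - t\<bar>" for s t
    proof -
      have "\<bar>G (x + s *\<^sub>R e) \<bullet> e - G (x + t *\<^sub>R e) \<bullet> e\<bar> \<le> norm (G (x + s *\<^sub>R e) - G (x + t *\<^sub>R e)) * norm e"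
        unfolding inner_diff_left[symmetric] by (rule Cauchy_Schwarz_ineq2)
      also have "\<dots> \<le> norm ((x + s *\<^sub>R e) - (x + t *\<^sub>R e))"
        using lip[of "x + s *\<^sub>R e" "x + t *\<^sub>R e"] e by (simp only: mult_1_right)
      also have "\<dots> = \<bar>s - t\<bar>"
        using e by (simp add: scaleR_diff_left[symmetric])
      finally show ?thesis .
    qed
    moreover have "((\<lambda>t. f (x + t *\<^sub>R e)) has_real_derivative G (x + t *\<^sub>R e) \<bullet> e)
        (at t within {0..norm (y - x)})" if "t \<in> {0..norm (y - x)}" for t
      using has_derivative_along_unit_segment[OF assms(1) \<open>x \<in> P\<close> \<open>y \<in> P\<close> \<open>x \<noteq> y\<close> that Dw]
      by (simp add: eq flip: e_def)
    ultimately show ?thesis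
      unfolding W2_infty_def eq mem_Collect_eq
      by (intro exI[of _ "\<lambda>t. G (x + t *\<^sub>R e) \<bullet> e"]) auto
  qed
  ultimately show ?thesis by (auto simp: W2_def)
qed

section \<open>Metric projections\<close>

text \<open>Sum of the two obtuse angle inequalities, each projection being tested against the
  other.\<close>

lemma closest_point_firmly_nonexpansive:
  fixes x y :: "'a::euclidean_space"
  assumes "convex S" "closed S" "S \<noteq> {}"
  shows "(norm (closest_point S x - closest_point S y))\<^sup>2
           \<le> (x - y) \<bullet> (closest_point S x - closest_point S y)"
proof -
  have "(x - closest_point S x) \<bullet> (closest_point S y - closest_point S x) \<le> 0"
    "(y - closest_point S y) \<bullet> (closest_point S x - closest_point S y) \<le> 0"
    using assms by (simp_all add: closest_point_dot closest_point_in_set)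
  then show ?thesis
    by (simp add: power2_norm_eq_inner algebra_simps inner_commute)
qed

text \<open>Up to sign this is the reflection 2p - id associated with the projection p. The triangle
  inequality would only give the constant 3; firm nonexpansiveness makes the last two terms of the
  expanded square add up to at most 0.\<close>

lemma norm_reflect_closest_point_le:
  fixes x y :: "'a::euclidean_space"
  assumes "convex S" "closed S" "S \<noteq> {}"
  shows "norm ((x - 2 *\<^sub>R closest_point S x) - (y - 2 *\<^sub>R closest_point S y)) \<le> norm (x - y)"
proof (rule power2_le_imp_le)
  let ?d = "closest_point S x - closest_point S y"
  have "(x - 2 *\<^sub>R closest_point S x) - (y - 2 *\<^sub>R closest_point S y) = (x - y) - 2 *\<^sub>R ?d"
    by (simp add: algebra_simps)
  then have "(norm ((x - 2 *\<^sub>R closest_point S x) - (y - 2 *\<^sub>R closest_point S y)))\<^sup>2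
      = (norm (x - y))\<^sup>2 - 4 * ((x - y) \<bullet> ?d) + 4 * (norm ?d)\<^sup>2"
    unfolding power2_norm_eq_inner
    by (simp only: inner_diff_left[of "x - y"] inner_diff_right[of _ "x - y"]) (simp add: inner_commute)
  then show "(norm ((x - 2 *\<^sub>R closest_point S x) - (y - 2 *\<^sub>R closest_point S y)))\<^sup>2 \<le> (norm (x - y))\<^sup>2"
    using closest_point_firmly_nonexpansive[OF assms, of x y] by linarith
qed simp

text \<open>An envelope argument: the projection of one point is a competitor for the other. This
  bounds the remainder from above and below by the square of \<open>norm (y - x)\<close>, although
  the projection itself may fail to be differentiable.\<close>

lemma has_derivative_dist_closest_point_square:
  fixes x :: "'a::euclidean_space"
  assumes "convex S" "closed S" "S \<noteq> {}"
  shows "((\<lambda>x. (norm (x - closest_point S x))\<^sup>2) has_derivative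
           (\<lambda>h. (2 *\<^sub>R (x - closest_point S x)) \<bullet> h)) (at x)"
\<comment> \<open>The radius 1 is arbitrary, as the bound below holds for every \<open>y\<close>
  other than \<open>x\<close>.\<close>
proof (rule has_derivativeI_sandwich[of 1])
  let ?p = "closest_point S" and ?q = "\<lambda>x. (norm (x - closest_point S x))\<^sup>2"
  show "bounded_linear (\<lambda>h. (2 *\<^sub>R (x - ?p x)) \<bullet> h)"
    by (rule bounded_linear_inner_right)
  have q_le: "?q a \<le> (norm (a - ?p b))\<^sup>2" for a b
    using closest_point_le[OF assms(2) closest_point_in_set[OF assms(2,3)], of a b]
    by (simp add: dist_norm power_mono)
  show "norm (?q y - ?q x - (2 *\<^sub>R (x - ?p x)) \<bullet> (y - x)) / norm (y - x) \<le> norm (y - x)"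
    if "y \<noteq> x" for y
  proof -
    have "(norm (y - ?p x))\<^sup>2 = ?q x + (2 *\<^sub>R (x - ?p x)) \<bullet> (y - x) + (norm (y - x))\<^sup>2"
      by (simp add: power2_norm_eq_inner algebra_simps inner_commute)
    then have 1: "?q y - ?q x - (2 *\<^sub>R (x - ?p x)) \<bullet> (y - x) \<le> (norm (y - x))\<^sup>2"
      using q_le[of y x] by linarith
    \<comment> \<open>For the lower bound the competitor \<open>?p y\<close> moves with
      \<open>y\<close>; nonexpansiveness keeps the resulting cross term of second order.\<close>
    have "(norm (x - ?p y))\<^sup>2 = ?q y - (2 *\<^sub>R (x - ?p x)) \<bullet> (y - x) - (norm (y - x))\<^sup>2
        + 2 * ((y - x) \<bullet> (?p y - ?p x))"
      by (simp add: power2_norm_eq_inner algebra_simps inner_commute)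
    moreover have "(y - x) \<bullet> (?p y - ?p x) \<le> (norm (y - x))\<^sup>2"
    proof -
      have "(y - x) \<bullet> (?p y - ?p x) \<le> norm (y - x) * norm (?p y - ?p x)"
        by (rule norm_cauchy_schwarz)
      also have "\<dots> \<le> norm (y - x) * norm (y - x)"
        using closest_point_lipschitz[OF assms, of y x] by (intro mult_left_mono) (auto simp: dist_norm)
      finally show ?thesis by (simp add: power2_eq_square)
    qed
    ultimately have "- (norm (y - x))\<^sup>2 \<le> ?q y - ?q x - (2 *\<^sub>R (x - ?p x)) \<bullet> (y - x)"
      using q_le[of x y] by linarith
    with 1 have "norm (?q y - ?q x - (2 *\<^sub>R (x - ?p x)) \<bullet> (y - x)) \<le> norm (y - x) * norm (y - x)"
      unfolding real_norm_def abs_le_iff power2_eq_square by linarith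
    then show ?thesis
      using that by (simp add: divide_le_eq)
  qed
  show "((\<lambda>y. norm (y - x)) \<longlongrightarrow> 0) (at x)"
    by (intro tendsto_eq_intros) auto
qed simp_all

section \<open>Simplices\<close>

lemma nondegenerate_iff_aff_dim:
  fixes v :: "nat \<Rightarrow> 'a::euclidean_space"
  shows "nondegenerate v \<longleftrightarrow> aff_dim (simplex_of v) = int DIM('a)"
proof
  assume nd: "nondegenerate v"
  show "aff_dim (simplex_of v) = int DIM('a)"
  proof (rule ccontr)
    assume "aff_dim (simplex_of v) \<noteq> int DIM('a)"
    then have "aff_dim (simplex_of v) < int DIM('a)"
      using aff_dim_le_DIM[of "simplex_of v"] by linarith
    then obtain a b where "a \<noteq> 0" "simplex_of v \<subseteq> {x. a \<bullet> x = b}"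
      by (rule aff_lowdim_subset_hyperplane)
    then show False
      using nd affine_hyperplane[of a b] by (auto simp: nondegenerate_def)
  qed
next
  assume full: "aff_dim (simplex_of v) = int DIM('a)"
  have "aff_dim H \<noteq> int DIM('a) - 1" if "simplex_of v \<subseteq> H" for H
    using aff_dim_subset[OF that] full by linarith
  then show "nondegenerate v"
    unfolding nondegenerate_def by blast
qed

text \<open>A counting argument: dimension d needs at least d + 1 points, and there are exactly d +
  1 indices.\<close>

lemma nondegenerate_independent:
  fixes v :: "nat \<Rightarrow> 'a::euclidean_space"
  assumes "nondegenerate v"
  shows "inj_on v (Sigma_idx TYPE('a))" "\<not> affine_dependent (v ` Sigma_idx TYPE('a))"
proof -
  let ?S = "Sigma_idx TYPE('a)"
  have fin: "finite ?S" "card ?S = Suc DIM('a)"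
    by (simp_all add: Sigma_idx_def)
  have dim: "aff_dim (v ` ?S) = int DIM('a)"
    using assms by (simp add: nondegenerate_iff_aff_dim simplex_of_def aff_dim_convex_hull)
  then have "int DIM('a) \<le> int (card (v ` ?S)) - 1"
    using aff_dim_le_card[of "v ` ?S"] fin by simp
  moreover have "card (v ` ?S) \<le> Suc DIM('a)"
    using card_image_le[OF fin(1)] fin(2) by metis
  ultimately have card: "card (v ` ?S) = Suc DIM('a)"
    by linarith
  then show "inj_on v ?S"
    using fin by (simp add: eq_card_imp_inj_on)
  show "\<not> affine_dependent (v ` ?S)"
    using fin dim card by (simp add: affine_independent_iff_card)
qed

lemma affine_combination_unique:
  assumes "finite I" "inj_on u I" "\<not> affine_dependent (u ` I)"
    and "sum a I = sum b I" "(\<Sum>i\<in>I. a i *\<^sub>R u i) = (\<Sum>i\<in>I. b i *\<^sub>R u i)" "i \<in> I"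
  shows "a i = b i"
proof (rule ccontr)
  assume ne: "a i \<noteq> b i"
  \<comment> \<open>Affine dependence speaks of coefficients attached to points, so the difference
    of the two families is transported from indices to points.\<close>
  define U where "U x = a (inv_into I u x) - b (inv_into I u x)" for x
  have U: "U (u j) = a j - b j" if "j \<in> I" for j
    using assms(2) that by (simp add: U_def)
  have "sum U (u ` I) = 0" "(\<Sum>x\<in>u ` I. U x *\<^sub>R x) = 0"
    using assms(4,5) by (simp_all add: sum.reindex[OF assms(2)] U sum_subtractf scaleR_diff_left)
  moreover have "U (u i) \<noteq> 0"
    using U assms(6) ne by simp
  ultimately have "affine_dependent (u ` I)"
    unfolding affine_dependent_explicit_finite[OF finite_imageI[OF assms(1)]]
    using assms(6) by blast
  then show False using assms(3) by simp
qed

text \<open>The choice in \<open>barycentric\<close> only guarantees the two sums. Nonnegativity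
  follows by uniqueness, from comparison with the coefficients of a convex combination.\<close>

lemma barycentric_simplex:
  fixes u :: "nat \<Rightarrow> 'a::euclidean_space"
  assumes "nondegenerate u" "x \<in> simplex_of u"
  shows "\<And>i. i \<in> Sigma_idx TYPE('a) \<Longrightarrow> 0 \<le> barycentric u x i"
    and "(\<Sum>i\<in>Sigma_idx TYPE('a). barycentric u x i) = 1"
    and "(\<Sum>i\<in>Sigma_idx TYPE('a). barycentric u x i *\<^sub>R u i) = x"
proof -
  let ?S = "Sigma_idx TYPE('a)"
  have fin: "finite ?S" by (simp add: Sigma_idx_def)
  note indep = nondegenerate_independent[OF assms(1)]
  obtain c where c: "\<And>y. y \<in> u ` ?S \<Longrightarrow> 0 \<le> c y" "sum c (u ` ?S) = 1"
    "(\<Sum>y\<in>u ` ?S. c y *\<^sub>R y) = x"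
    using assms(2) fin by (auto simp: simplex_of_def convex_hull_finite)
  then have c': "(\<Sum>i\<in>?S. c (u i)) = 1" "(\<Sum>i\<in>?S. c (u i) *\<^sub>R u i) = x"
    by (simp_all add: sum.reindex[OF indep(1)])
  then have "\<exists>b. (\<Sum>i\<in>?S. b i) = 1 \<and> (\<Sum>i\<in>?S. b i *\<^sub>R u i) = x"
    by blast
  from someI_ex[OF this] show sums: "(\<Sum>i\<in>?S. barycentric u x i) = 1"
    "(\<Sum>i\<in>?S. barycentric u x i *\<^sub>R u i) = x"
    by (simp_all add: barycentric_def)
  show "0 \<le> barycentric u x i" if "i \<in> ?S" for i
    using affine_combination_unique[OF fin indep, of "barycentric u x" "\<lambda>i. c (u i)" i] sums c' c(1) that
    by auto
qed

text \<open>The description operator requires existence and uniqueness. Equidistance amounts to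
  linear equations for the inner products of \<open>c\<close> with \<open>v i - v 0\<close>; these
  are solvable because the nonzero differences are independent, and uniquely so because the vertices
  span the space affinely.\<close>

lemma circumcenter_equidistant:
  fixes v :: "nat \<Rightarrow> 'a::euclidean_space"
  assumes "nondegenerate v" "i \<in> Sigma_idx TYPE('a)"
  shows "norm (circumcenter v - v i) = circumradius v"
proof -
  let ?S = "Sigma_idx TYPE('a)"
  note indep = nondegenerate_independent[OF assms(1)]
  have 0: "0 \<in> ?S" by (simp add: Sigma_idx_def)
  have norm_eq: "norm (c - v i) = norm (c - v 0) \<longleftrightarrow> c \<bullet> (v i - v 0) = (v i \<bullet> v i - v 0 \<bullet> v 0) / 2" for c i
    unfolding norm_eq by (auto simp: algebra_simps inner_commute)
  have "independent ((\<lambda>x. - v 0 + x) ` (v ` ?S - {v 0}))"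
    using indep(2) affine_dependent_iff_dependent2[of "v 0" "v ` ?S"] 0 by blast
  \<comment> \<open>The prescribed value is that for \<open>x = v i - v 0\<close>, so
    \<open>x + v 0\<close> recovers the vertex.\<close>
  from linear_independent_extend[OF this, of "\<lambda>x. ((x + v 0) \<bullet> (x + v 0) - v 0 \<bullet> v 0) / 2"]
  obtain L :: "'a \<Rightarrow> real" where lin: "linear L"
    and L: "\<And>x. x \<in> (\<lambda>x. - v 0 + x) ` (v ` ?S - {v 0}) \<Longrightarrow> L x = ((x + v 0) \<bullet> (x + v 0) - v 0 \<bullet> v 0) / 2"
    by blast
  have L': "L (v i - v 0) = (v i \<bullet> v i - v 0 \<bullet> v 0) / 2" if "i \<in> ?S" for i
  proof (cases "v i = v 0")
    case False
    then have "- v 0 + v i \<in> (\<lambda>x. - v 0 + x) ` (v ` ?S - {v 0})"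
      using that by blast
    from L[OF this] show ?thesis by simp
  qed (simp add: linear_0[OF lin])
  \<comment> \<open>The vector representing the functional \<open>L\<close>.\<close>
  define c where "c = adjoint L 1"
  have c: "c \<bullet> x = L x" for x
    using adjoint_works[OF lin, of x 1] by (simp add: c_def inner_commute)
  have "\<forall>i\<in>?S. norm (c - v i) = norm (c - v 0)"
    by (simp add: norm_eq c L')
  moreover have "c' = c" if c': "\<forall>i\<in>?S. norm (c' - v i) = r" for c' r
  proof -
    have "(c' - c) \<bullet> v i = (c' - c) \<bullet> v 0" if "i \<in> ?S" for i
    proof -
      have "norm (c' - v i) = norm (c' - v 0)"
        using c' that 0 by simp
      then have "c' \<bullet> (v i - v 0) = c \<bullet> (v i - v 0)"
        using c L'[OF that] by (simp only: norm_eq)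
      then show ?thesis
        unfolding inner_diff_left inner_diff_right by linarith
    qed
    then have "c' - c = 0"
      using assms(1) by (intro inner_constant_imp_0[of "v ` ?S" "c' - c" "(c' - c) \<bullet> v 0"])
        (auto simp: nondegenerate_iff_aff_dim simplex_of_def aff_dim_convex_hull)
    then show ?thesis by simp
  qed
  ultimately have "\<exists>!c. \<exists>r. \<forall>i\<in>?S. norm (c - v i) = r"
    by metis
  from theI'[OF this] obtain r where "\<forall>i\<in>?S. norm (circumcenter v - v i) = r"
    unfolding circumcenter_def by blast
  then show ?thesis
    using assms(2) 0 by (simp add: circumradius_def)
qed

section \<open>The simplex U and the projection onto it\<close>

lemma nondegenerate_half_vertex:
  fixes v :: "nat \<Rightarrow> 'a::euclidean_space"
  assumes "nondegenerate v"
  shows "nondegenerate (half_vertex v)"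
proof -
  let ?S = "Sigma_idx TYPE('a)"
  have "half_vertex v ` ?S = (+) ((1/2) *\<^sub>R circumcenter v) ` ((*\<^sub>R) (1/2) ` (v ` ?S))"
    by (simp add: image_image half_vertex_def scaleR_add_right)
  moreover have "aff_dim ((*\<^sub>R) (1/2) ` (v ` ?S)) = aff_dim (v ` ?S)"
    by (rule aff_dim_injective_linear_image) (auto intro!: injI linearI simp: scaleR_add_right)
  ultimately show ?thesis
    using assms
    by (simp add: nondegenerate_iff_aff_dim simplex_of_def aff_dim_convex_hull aff_dim_translation_eq)
qed

lemma half_simplex_props:
  fixes v :: "nat \<Rightarrow> 'a::euclidean_space"
  shows "convex (half_simplex v)" "closed (half_simplex v)" "half_simplex v \<noteq> {}"
proof -
  have "finite (half_vertex v ` Sigma_idx TYPE('a))" "Sigma_idx TYPE('a) \<noteq> {}"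
    by (simp_all add: Sigma_idx_def)
  then show "convex (half_simplex v)" "closed (half_simplex v)" "half_simplex v \<noteq> {}"
    by (simp_all add: half_simplex_def simplex_of_def finite_imp_compact_convex_hull compact_imp_closed)
qed

text \<open>All vertices lie on a sphere around the circumcenter, so by Cauchy-Schwarz the
  functional with direction \<open>v i - circumcenter v\<close> is largest at \<open>v i\<close>
  among them. Hence U lies in the half-space through \<open>half_vertex v i\<close> that faces away
  from \<open>v i\<close>.\<close>

lemma proj_vertex:
  fixes v :: "nat \<Rightarrow> 'a::euclidean_space"
  assumes "nondegenerate v" "i \<in> Sigma_idx TYPE('a)"
  shows "proj v (v i) = half_vertex v i"
proof -
  let ?S = "Sigma_idx TYPE('a)" and ?c = "circumcenter v" and ?u = "half_vertex v"
  have le: "(v i - ?u i) \<bullet> ?u j \<le> (v i - ?u i) \<bullet> ?u i" if "j \<in> ?S" for j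
  proof -
    have "(v i - ?c) \<bullet> (v j - ?c) \<le> norm (v i - ?c) * norm (v j - ?c)"
      by (rule norm_cauchy_schwarz)
    also have "\<dots> = norm (v i - ?c) * norm (v i - ?c)"
      using circumcenter_equidistant[OF assms(1)] that assms(2) by (simp add: norm_minus_commute)
    also have "\<dots> = (v i - ?c) \<bullet> (v i - ?c)"
      by (simp add: power2_norm_eq_inner flip: power2_eq_square)
    finally have "(v i - ?c) \<bullet> (v j - v i) \<le> 0"
      by (simp add: inner_diff_right)
    moreover have "v i - ?u i = (1/2) *\<^sub>R (v i - ?c)" "?u j - ?u i = (1/2) *\<^sub>R (v j - v i)"
      by (simp_all add: half_vertex_def algebra_simps flip: scaleR_add_left)
    ultimately have "(v i - ?u i) \<bullet> (?u j - ?u i) \<le> 0"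
      by simp
    then show ?thesis by (simp add: inner_diff_right)
  qed
  have "half_simplex v \<subseteq> {x. (v i - ?u i) \<bullet> x \<le> (v i - ?u i) \<bullet> ?u i}"
    unfolding half_simplex_def simplex_of_def
    by (intro hull_minimal convex_halfspace_le) (auto intro: le)
  then have *: "(v i - ?u i) \<bullet> (z - ?u i) \<le> 0" if "z \<in> half_simplex v" for z
    using that by (auto simp: inner_diff_right)
  have "?u i = closest_point (half_simplex v) (v i)"
  proof (rule closest_point_unique[OF half_simplex_props(1,2)])
    show "?u i \<in> half_simplex v"
      using assms(2) by (simp add: half_simplex_def simplex_of_def hull_inc)
    show "\<forall>z\<in>half_simplex v. dist (v i) (?u i) \<le> dist (v i) z"
    proof
      fix z assume "z \<in> half_simplex v"
      have "(norm (v i - z))\<^sup>2 = (norm (v i - ?u i))\<^sup>2 - 2 * ((v i - ?u i) \<bullet> (z - ?u i)) + (norm (z - ?u i))\<^sup>2"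
        by (simp add: power2_norm_eq_inner algebra_simps inner_commute)
      then have "(norm (v i - ?u i))\<^sup>2 \<le> (norm (v i - z))\<^sup>2"
        using *[OF \<open>z \<in> half_simplex v\<close>] zero_le_power2[of "norm (z - ?u i)"] by linarith
      then show "dist (v i) (?u i) \<le> dist (v i) z"
        unfolding dist_norm by (rule power2_le_imp_le) simp
    qed
  qed
  then show ?thesis by (simp add: proj_def)
qed

section \<open>The extremal function\<close>

lemma has_derivative_error_fun:
  "(error_fun v has_derivative (\<lambda>h. (x - 2 *\<^sub>R proj v x + circumcenter v) \<bullet> h)) (at x)"
proof -
  have "((\<lambda>x. (norm (x - circumcenter v))\<^sup>2 / 2) has_derivative (\<lambda>h. (x - circumcenter v) \<bullet> h)) (at x)"
    unfolding power2_norm_eq_inner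
    by (auto intro!: derivative_eq_intros simp: inner_commute)
  moreover have "((\<lambda>x. (norm (x - proj v x))\<^sup>2) has_derivative (\<lambda>h. (2 *\<^sub>R (x - proj v x)) \<bullet> h)) (at x)"
    unfolding proj_def by (rule has_derivative_dist_closest_point_square[OF half_simplex_props])
  ultimately have "(error_fun v has_derivative
      (\<lambda>h. 0 + (2 *\<^sub>R (x - proj v x)) \<bullet> h - (x - circumcenter v) \<bullet> h)) (at x)"
    unfolding error_fun_def[abs_def]
    by (intro has_derivative_diff has_derivative_add has_derivative_const)
  then show ?thesis
    by (rule has_derivative_eq_rhs) (simp add: fun_eq_iff algebra_simps)
qed

lemma error_fun_in_W2:
  fixes P :: "'a::euclidean_space set"
  assumes "convex P" "aff_dim P = int DIM('a)"
  shows "error_fun v \<in> W2 P"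
proof (rule W2_I[OF assms has_derivative_error_fun])
  show "norm ((x - 2 *\<^sub>R proj v x + circumcenter v) - (y - 2 *\<^sub>R proj v y + circumcenter v)) \<le> norm (x - y)"
    for x y
    using norm_reflect_closest_point_le[OF half_simplex_props[of v], of x y] by (simp add: proj_def)
qed

lemma info_error_fun:
  fixes v :: "nat \<Rightarrow> 'a::euclidean_space"
  assumes "nondegenerate v" "convex P" "aff_dim P = int DIM('a)" "simplex_of v \<subseteq> P"
    and "i \<in> Sigma_idx TYPE('a)"
  shows "info P v (error_fun v) i = 0"
proof -
  have vi: "v i \<in> P"
    using assms(4,5) by (auto simp: simplex_of_def hull_inc)
  have "gradient_within P (error_fun v) (v i) = v i - 2 *\<^sub>R proj v (v i) + circumcenter v"
    by (rule gradient_within_eq[OF assms(2,3) vi has_derivative_at_withinI[OF has_derivative_error_fun]])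
  also have "\<dots> = 0"
    using assms by (simp add: proj_vertex half_vertex_def)
  finally have grad: "gradient_within P (error_fun v) (v i) = 0" .
  \<comment> \<open>The projection is halfway to the circumcenter, so the value is R^2/4 + R^2/4 -
    R^2/2 = 0.\<close>
  have "v i - proj v (v i) = (- (1/2)) *\<^sub>R (circumcenter v - v i)"
    using assms by (simp add: proj_vertex half_vertex_def algebra_simps flip: scaleR_add_left)
  then have "norm (v i - proj v (v i)) = circumradius v / 2"
    using circumcenter_equidistant[OF assms(1,5)] by simp
  moreover have "norm (v i - circumcenter v) = circumradius v"
    using circumcenter_equidistant[OF assms(1,5)] by (simp add: norm_minus_commute)
  ultimately have "error_fun v (v i) = 0"
    unfolding error_fun_def by (simp only: power_divide) simp
  with grad show ?thesis by (simp add: info_def zero_prod_def)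
qed

section \<open>The upper bound for functions with zero information\<close>

lemma W2_le_error_fun:
  fixes v :: "nat \<Rightarrow> 'a::euclidean_space"
  assumes nd: "nondegenerate v" and adm: "admissible_domain v P" and w: "w \<in> P"
    and dim: "aff_dim P = int DIM('a)"
    and f: "f \<in> W2 P" and info: "\<And>i. i \<in> Sigma_idx TYPE('a) \<Longrightarrow> info P v f i = 0"
  shows "f w \<le> error_fun v w"
proof -
  let ?S = "Sigma_idx TYPE('a)" and ?u = "half_vertex v" and ?c = "circumcenter v"
    and ?q = "proj v w" and ?R = "circumradius v" and ?g = "gradient_within P f w"
  define b where "b = barycentric ?u ?q"
  define p where "p = w - ?q"
  have convex: "convex P" and T: "simplex_of v \<subseteq> P"
    using adm by (auto simp: admissible_domain_def)
  have "?q \<in> half_simplex v"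
    by (simp add: proj_def closest_point_in_set half_simplex_props)
  then have q: "?q \<in> simplex_of ?u"
    by (simp add: half_simplex_def)
  note bary = barycentric_simplex[OF nondegenerate_half_vertex[OF nd] q, folded b_def]
  \<comment> \<open>The support of the barycentric coordinates: the index set of the open face that
    contains the projection.\<close>
  define I where "I = {i \<in> ?S. b i > 0}"
  have I: "b i = 0" if "i \<in> ?S - I" for i
    using bary(1)[of i] that by (auto simp: I_def)
  have "I \<noteq> {}"
  proof
    assume "I = {}"
    then have "(\<Sum>i\<in>?S. b i) = 0" using I by (intro sum.neutral) auto
    then show False using bary(2) by simp
  qed
  moreover have "?q \<in> open_face v I"
    using \<open>?q \<in> half_simplex v\<close> I by (auto simp: open_face_def I_def simp flip: b_def)
  moreover have "I \<subseteq> ?S" by (auto simp: I_def)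
  ultimately have y: "p + ?u i \<in> P" if "i \<in> I" for i
    using adm w that unfolding admissible_domain_def p_def by blast
  \<comment> \<open>The bound from the two Taylor estimates through \<open>p + ?u i\<close>. It
    depends on \<open>i\<close> only through \<open>?u i\<close>, and affinely, so it can be
    averaged with barycentric weights.\<close>
  define K where "K i = ?R\<^sup>2 / 4 + (norm p)\<^sup>2 / 2 + (norm (?q - ?c))\<^sup>2 / 2 - (?u i - ?c) \<bullet> (w - ?c)
      - ?g \<bullet> (?u i - ?q)" for i
  have fw: "f w \<le> K i" if "i \<in> I" for i
  proof -
    have i: "i \<in> ?S" using that by (simp add: I_def)
    have vi: "v i \<in> P"
      using T i by (auto simp: simplex_of_def hull_inc)
    have "f (v i) = 0" "gradient_within P f (v i) = 0"
      using info[OF i] by (auto simp: info_def zero_prod_def)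
    then have 1: "f (p + ?u i) \<le> (norm (p + ?u i - v i))\<^sup>2 / 2"
      using W2_taylor[OF convex dim f vi y[OF that]] by simp
    have 2: "f w \<le> f (p + ?u i) - ?g \<bullet> (p + ?u i - w) + (norm (p + ?u i - w))\<^sup>2 / 2"
      using W2_taylor[OF convex dim f w y[OF that]] by linarith
    \<comment> \<open>The quadratic terms in \<open>?u i\<close> become constant because every
      \<open>?u i\<close> has distance R/2 from the circumcenter.\<close>
    define z where "z = ?u i - ?c"
    have "z = (- (1/2)) *\<^sub>R (?c - v i)"
      by (simp add: z_def half_vertex_def algebra_simps flip: scaleR_add_left)
    then have z: "(norm z)\<^sup>2 = ?R\<^sup>2 / 4"
      using circumcenter_equidistant[OF nd i] by (simp add: power_divide)
    have pv: "p + ?u i - v i = p - z"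
      by (simp add: z_def half_vertex_def algebra_simps flip: scaleR_add_left)
    have 3: "(norm (p + ?u i - v i))\<^sup>2 = (norm p)\<^sup>2 - 2 * (z \<bullet> p) + (norm z)\<^sup>2"
      unfolding pv by (simp add: power2_norm_eq_inner algebra_simps inner_commute)
    have pw: "p + ?u i - w = z - (?q - ?c)" "?u i - ?q = z - (?q - ?c)"
      by (simp_all add: p_def z_def)
    have 4: "(norm (p + ?u i - w))\<^sup>2 = (norm z)\<^sup>2 - 2 * (z \<bullet> (?q - ?c)) + (norm (?q - ?c))\<^sup>2"
      unfolding pw by (simp add: power2_norm_eq_inner algebra_simps inner_commute)
    have "w - ?c = p + (?q - ?c)"
      by (simp add: p_def)
    then have 5: "z \<bullet> (w - ?c) = z \<bullet> p + z \<bullet> (?q - ?c)"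
      by (simp only: inner_add_right)
    have 6: "?g \<bullet> (p + ?u i - w) = ?g \<bullet> (?u i - ?q)"
      by (simp only: pw)
    show ?thesis
      using 1 2 3 4 5 6 z unfolding K_def z_def[symmetric] by argo
  qed
  have "f w = (\<Sum>i\<in>?S. b i * f w)"
    by (simp add: bary(2) flip: sum_distrib_right)
  also have "\<dots> \<le> (\<Sum>i\<in>?S. b i * K i)"
  proof (rule sum_mono)
    fix i assume "i \<in> ?S"
    then show "b i * f w \<le> b i * K i"
      \<comment> \<open>Outside \<open>I\<close> the weight is zero, so \<open>fw\<close> is called
        upon only where \<open>p + ?u i\<close> is known to lie in \<open>P\<close>.\<close>
      using fw[of i] I[of i] bary(1)[of i] by (cases "i \<in> I") (auto intro: mult_left_mono)
  qed
  also have "\<dots> = ?R\<^sup>2 / 4 + (norm p)\<^sup>2 / 2 + (norm (?q - ?c))\<^sup>2 / 2 - (?q - ?c) \<bullet> (w - ?c)"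
  proof -
    \<comment> \<open>Averaging replaces \<open>?u i\<close> by \<open>?q\<close>; with
      \<open>d = ?q\<close> the unknown gradient term drops out.\<close>
    have mean: "(\<Sum>i\<in>?S. b i * (a \<bullet> (?u i - d))) = a \<bullet> (?q - d)" for a d
    proof -
      have "(\<Sum>i\<in>?S. b i * (a \<bullet> (?u i - d))) = a \<bullet> (\<Sum>i\<in>?S. b i *\<^sub>R ?u i) - (\<Sum>i\<in>?S. b i) * (a \<bullet> d)"
        by (simp add: inner_sum_right inner_diff_right right_diff_distrib sum_subtractf sum_distrib_right)
      then show ?thesis by (simp add: bary inner_diff_right)
    qed
    have "(\<Sum>i\<in>?S. b i * K i) = (\<Sum>i\<in>?S. b i) * (?R\<^sup>2 / 4 + (norm p)\<^sup>2 / 2 + (norm (?q - ?c))\<^sup>2 / 2)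
        - (\<Sum>i\<in>?S. b i * ((w - ?c) \<bullet> (?u i - ?c))) - (\<Sum>i\<in>?S. b i * (?g \<bullet> (?u i - ?q)))"
      unfolding K_def right_diff_distrib sum_subtractf sum_distrib_right
      by (simp only: inner_commute[of "w - ?c"])
    then show ?thesis
      unfolding mean bary(2) by (simp add: inner_commute)
  qed
  also have "\<dots> = error_fun v w"
  proof -
    \<comment> \<open>With \<open>w - ?c = p + e\<close> both sides equal R^2/4 + |p|^2/2 - p.e -
      |e|^2/2.\<close>
    define e where "e = ?q - ?c"
    have eq: "w - ?c = p + e" by (simp add: p_def e_def)
    show ?thesis
      unfolding error_fun_def eq p_def[symmetric] e_def[symmetric] power2_norm_eq_inner
      by (simp add: inner_add_left inner_add_right inner_commute field_simps)
  qed
  finally show ?thesis .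
qed

theorem corollary4p4:
  fixes v :: "nat \<Rightarrow> 'a::euclidean_space" and P :: "'a set" and w :: 'a
  assumes "nondegenerate v"
    and "admissible_domain v P"
    and "w \<in> P"
  shows "(SUP f \<in> {f \<in> W2 P. \<forall>i\<in>Sigma_idx TYPE('a). info P v f i = 0}. ereal (f w))
           = ereal (error_fun v w)"
proof (rule antisym)
  have convex: "convex P" and T: "simplex_of v \<subseteq> P"
    using assms(2) by (auto simp: admissible_domain_def)
  have dim: "aff_dim P = int DIM('a)"
    using assms(1) aff_dim_subset[OF T] aff_dim_le_DIM[of P]
    by (simp add: nondegenerate_iff_aff_dim)
  show "(SUP f \<in> {f \<in> W2 P. \<forall>i\<in>Sigma_idx TYPE('a). info P v f i = 0}. ereal (f w))
      \<le> ereal (error_fun v w)"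
    using W2_le_error_fun[OF assms dim] by (auto intro!: SUP_least)
  \<comment> \<open>The error function belongs to the set, so the supremum is a maximum.\<close>
  show "ereal (error_fun v w)
      \<le> (SUP f \<in> {f \<in> W2 P. \<forall>i\<in>Sigma_idx TYPE('a). info P v f i = 0}. ereal (f w))"
    using error_fun_in_W2[OF convex dim] info_error_fun[OF assms(1) convex dim T]
    by (intro SUP_upper) auto
qed

end
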